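(* For the branching-within-branching process described in the context, suppose $\mathbb{P}(\mathsf{Surv})>0$. (a) If $\mathbb{P}_2(\mathcal{T}_1^*\ge2)>0$, then for all $z\in\mathbb{N}$, $\mathbb{P}_z(\mathcal{T}_n^*\to\infty\mid\mathsf{Surv})=1$, and thus $\mathsf{Ext}=\{\sup_{n\ge0}\mathcal{T}_n^*<\infty\}$ $\mathbb{P}_z$-a.s. (b) If $\mathbb{P}_2(\mathcal{T}_1^*\ge2)=0$, then for all $z\in\mathbb{N}$, $\mathbb{P}_z(\mathcal{T}_n^*=1\text{ for all }n\ge0\mid\mathsf{Surv})=1$.
   Context: Branching-within-branching process (BwBP): Let $\mathbb{V}$ be the Ulam-Harris tree with root $\varnothing$. Let $(N_\mathsf{v})_{\mathsf{v}\in\mathbb{V}}$ be i.i.d. copies of an $\mathbb{N}_0$-valued random variable $N$ with law $(p_k)_{k\ge0}$ and finite mean $\nu=\mathbb{E}N$; each cell $\mathsf{v}$ has $N_\mathsf{v}$ daughter cells $\mathsf{v}1,\dots,\mathsf{v}N_\mathsf{v}$, giving a Galton-Watson cell tree with generations $\mathbb{T}_n$ ($\mathbb{T}_0=\{\varnothing\}$). For each $k\in\mathbb{N}$ let $X^{(\bullet,k)}=(X^{(1,k)},\dots,X^{(k,k)})$ be an $\mathbb{N}_0^k$-valued random vector and $X^{(\bullet,k)}_{i,\mathsf{v}}$ i.i.d. copies, independent over $k$ and of $(N_\mathsf{v})$; $X^{(j,k)}_{i,\mathsf{v}}:=0$ for $j>k$. Parasite numbers: $Z_{\mathsf{v}j}=\sum_{i=1}^{Z_\mathsf{v}}X^{(j,N_\mathsf{v})}_{i,\mathsf{v}}$.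 $\mathcal{Z}_n=\sum_{\mathsf{v}\in\mathbb{T}_n}Z_\mathsf{v}$, and $\mathcal{T}_n^*=\#\{\mathsf{v}\in\mathbb{T}_n:Z_\mathsf{v}>0\}$ is the number of contaminated cells in generation $n$. $\mathbb{P}_z$ is the law when starting with one cell containing $z$ parasites; $\mathbb{P}=\mathbb{P}_1$. $\mathsf{Ext}=\{\mathcal{Z}_n\to0\}$, $\mathsf{Surv}=\mathsf{Ext}^c$ (which a.s. equals $\{\mathcal{Z}_n\to\infty\}$). Put $\mu_{j,k}=\mathbb{E}X^{(j,k)}$, $\gamma=\sum_{k\ge1}p_k\sum_{j=1}^k\mu_{j,k}$. Standing assumptions: $0<\gamma<\infty$; $p_1<1$ and $\mathbb{P}(\mathcal{Z}_1=1)<1$; $p_k\,\mathbb{P}(X^{(j,k)}\ge2)>0$ for at least one pair $1\le j\le k$. *)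

theory Defs
  imports "HOL-Probability.Probability"
begin

text \<open>Ulam-Harris tree encoded by nat lists with positive entries; the daughter
  cell number j of cell v is the list j # v (latest generation at the head).\<close>

definition UH :: "nat list set" where
  "UH = {v. \<forall>j\<in>set v. 1 \<le> j}"

text \<open>N v : number of daughter cells of cell v.
  X k i v : the i-th copy (parasite i) at cell v of the random vector X^(.,k),
  given as a list of length k; component j (1-based) is X k i v ! (j - 1).\<close>

fun in_tree :: "(nat list \<Rightarrow> 'a \<Rightarrow> nat) \<Rightarrow> 'a \<Rightarrow> nat list \<Rightarrow> bool" where
  "in_tree N \<omega> [] = True"
| "in_tree N \<omega> (j # v) = (in_tree N \<omega> v \<and> 1 \<le> j \<and> j \<le> N v \<omega>)"

definition gen :: "(nat list \<Rightarrow> 'a \<Rightarrow> nat) \<Rightarrow> 'a \<Rightarrow> nat \<Rightarrow> nat list set" where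
  "gen N \<omega> n = {v. length v = n \<and> in_tree N \<omega> v}"

fun Zp :: "(nat list \<Rightarrow> 'a \<Rightarrow> nat) \<Rightarrow> (nat \<Rightarrow> nat \<Rightarrow> nat list \<Rightarrow> 'a \<Rightarrow> nat list)
           \<Rightarrow> nat \<Rightarrow> nat list \<Rightarrow> 'a \<Rightarrow> nat" where
  "Zp N X z [] \<omega> = z"
| "Zp N X z (j # v) \<omega> =
     (if 1 \<le> j \<and> j \<le> N v \<omega>
      then (\<Sum>i = 1..Zp N X z v \<omega>. X (N v \<omega>) i v \<omega> ! (j - 1)) else 0)"

definition totalZ where
  "totalZ N X z n \<omega> = (\<Sum>v\<in>gen N \<omega> n. Zp N X z v \<omega>)"

definition contam where
  "contam N X z n \<omega> = card {v \<in> gen N \<omega> n. 0 < Zp N X z v \<omega>}"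

definition Ext :: "'a measure \<Rightarrow> _ \<Rightarrow> _ \<Rightarrow> nat \<Rightarrow> 'a set" where
  "Ext M N X z = {\<omega> \<in> space M. (\<lambda>n. totalZ N X z n \<omega>) \<longlonglongrightarrow> 0}"

definition Surv :: "'a measure \<Rightarrow> _ \<Rightarrow> _ \<Rightarrow> nat \<Rightarrow> 'a set" where
  "Surv M N X z = space M - Ext M N X z"

definition bwbp_model :: "'a measure \<Rightarrow> (nat list \<Rightarrow> 'a \<Rightarrow> nat)
     \<Rightarrow> (nat \<Rightarrow> nat \<Rightarrow> nat list \<Rightarrow> 'a \<Rightarrow> nat list) \<Rightarrow> bool" where
  "bwbp_model M N X \<longleftrightarrow>
     prob_space M \<and>
     prob_space.indep_vars M (\<lambda>_. count_space UNIV)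
       (\<lambda>a \<omega>. case a of Inl v \<Rightarrow> (Inl (N v \<omega>) :: nat + nat list)
                      | Inr (k, i, v) \<Rightarrow> Inr (X k i v \<omega>))
       (Inl ` UH \<union> Inr ` {(k, i, v). 1 \<le> k \<and> 1 \<le> i \<and> v \<in> UH}) \<and>
     (\<forall>v\<in>UH. distr M (count_space UNIV) (N v) = distr M (count_space UNIV) (N [])) \<and>
     (\<forall>k i v. 1 \<le> k \<and> 1 \<le> i \<and> v \<in> UH \<longrightarrow>
        distr M (count_space UNIV) (X k i v) = distr M (count_space UNIV) (X k 1 [])) \<and>
     (\<forall>k i v. 1 \<le> k \<and> 1 \<le> i \<and> v \<in> UH \<longrightarrow> (\<forall>\<omega>\<in>space M. length (X k i v \<omega>) = k))"

definition bwbp_gamma :: "'a measure \<Rightarrow> (nat list \<Rightarrow> 'a \<Rightarrow> nat)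
     \<Rightarrow> (nat \<Rightarrow> nat \<Rightarrow> nat list \<Rightarrow> 'a \<Rightarrow> nat list) \<Rightarrow> ennreal" where
  "bwbp_gamma M N X =
     (\<Sum>k. ennreal (measure M {\<omega> \<in> space M. N [] \<omega> = k}) *
          (\<Sum>j = 1..k. \<integral>\<^sup>+ \<omega>. ennreal (real (X k 1 [] \<omega> ! (j - 1))) \<partial>M))"

end

theory Submission
  imports Defs
begin

text \<open>
  Survival means that there is at least one contaminated cell in every generation. Two
  parasites in one cell can contaminate two daughters, and one parasite can have two
  descendants in one daughter cell; since the subtrees of distinct cells are independent copies of
  the whole process, a single parasite therefore produces with some probability \<open>p > 0\<close> at
  least two contaminated cells in all generations from the second on. By monotonicity in the
  number of parasites, whenever there are exactly \<open>s \<ge> 1\<close> contaminated cells, their number stays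
  at least \<open>2 s > s\<close> from two generations later on with conditional probability at least
  \<open>p ^ s\<close>. Hence no value \<open>s \<ge> 1\<close> is taken infinitely often.

  If two parasites almost surely contaminate at most one daughter, then, the offspring vectors
  being compared pairwise, so do any number of parasites.
\<close>

section \<open>Contaminated cells\<close>

definition infected :: "(nat list \<Rightarrow> 'a \<Rightarrow> nat) \<Rightarrow> (nat \<Rightarrow> nat \<Rightarrow> nat list \<Rightarrow> 'a \<Rightarrow> nat list)
    \<Rightarrow> nat \<Rightarrow> nat \<Rightarrow> 'a \<Rightarrow> nat list set" where
  "infected N X z n \<omega> = {v \<in> gen N \<omega> n. 0 < Zp N X z v \<omega>}"

lemma contam_eq_card_infected: "contam N X z n \<omega> = card (infected N X z n \<omega>)"
  by (simp add: contam_def infected_def)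

lemma append_in_UH [simp]: "u @ v \<in> UH \<longleftrightarrow> u \<in> UH \<and> v \<in> UH"
  by (auto simp: UH_def)

lemma Nil_in_UH [simp]: "[] \<in> UH"
  by (simp add: UH_def)

lemma Cons_in_UH [simp]: "j # v \<in> UH \<longleftrightarrow> 1 \<le> j \<and> v \<in> UH"
  by (auto simp: UH_def)

lemma in_tree_imp_UH: "in_tree N \<omega> v \<Longrightarrow> v \<in> UH"
  by (induction v) auto

lemma gen_0 [simp]: "gen N \<omega> 0 = {[]}"
  by (auto simp: gen_def)

lemma gen_Suc: "gen N \<omega> (Suc n) = (\<Union>v\<in>gen N \<omega> n. (\<lambda>j. j # v) ` {1..N v \<omega>})"
  by (auto simp: gen_def length_Suc_conv)

lemma finite_gen [simp]: "finite (gen N \<omega> n)"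
  by (induction n) (auto simp: gen_Suc)

lemma finite_infected [simp]: "finite (infected N X z n \<omega>)"
  by (simp add: infected_def)

lemma infected_subset_UH: "infected N X z n \<omega> \<subseteq> {v \<in> UH. length v = n}"
  by (auto simp: infected_def gen_def in_tree_imp_UH)

lemma in_tree_append:
  "in_tree N \<omega> (u @ v) \<longleftrightarrow> in_tree (\<lambda>u. N (u @ v)) \<omega> u \<and> in_tree N \<omega> v"
  by (induction u) auto

lemma Zp_mono_append:
  assumes "y \<le> Zp N X z v \<omega>"
  shows "Zp (\<lambda>u. N (u @ v)) (\<lambda>k i u. X k i (u @ v)) y u \<omega> \<le> Zp N X z (u @ v) \<omega>"
  using assms by (induction u) (auto intro!: sum_mono2)

lemma Zp_mono: "y \<le> z \<Longrightarrow> Zp N X y v \<omega> \<le> Zp N X z v \<omega>"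
  using Zp_mono_append[of y N X z "[]"] by simp

lemma contam_mono: "y \<le> z \<Longrightarrow> contam N X y n \<omega> \<le> contam N X z n \<omega>"
  unfolding contam_eq_card_infected infected_def
  by (intro card_mono) (auto intro: less_le_trans[OF _ Zp_mono])

lemma contam_Suc_eq_0: "contam N X z n \<omega> = 0 \<Longrightarrow> contam N X z (Suc n) \<omega> = 0"
  by (auto simp: contam_def gen_Suc)

lemma contam_eq_0_mono:
  assumes "n \<le> m" "contam N X z n \<omega> = 0"
  shows "contam N X z m \<omega> = 0"
  using assms by (induction m rule: dec_induct) (simp_all add: contam_Suc_eq_0)

lemma totalZ_eq_0_iff: "totalZ N X z n \<omega> = 0 \<longleftrightarrow> contam N X z n \<omega> = 0"
  by (auto simp: totalZ_def contam_def)

lemma Ext_eq: "Ext M N X z = {\<omega> \<in> space M. \<exists>n. contam N X z n \<omega> = 0}"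
proof -
  have "(\<lambda>n. totalZ N X z n \<omega>) \<longlonglongrightarrow> 0 \<longleftrightarrow> (\<exists>n. contam N X z n \<omega> = 0)" for \<omega>
  proof -
    have "(\<lambda>n. totalZ N X z n \<omega>) \<longlonglongrightarrow> 0 \<longleftrightarrow> eventually (\<lambda>n. totalZ N X z n \<omega> = 0) sequentially"
      by (simp add: tendsto_discrete)
    also have "\<dots> \<longleftrightarrow> (\<exists>n. contam N X z n \<omega> = 0)"
      by (auto simp: totalZ_eq_0_iff eventually_sequentially dest: contam_eq_0_mono)
    finally show ?thesis .
  qed
  then show ?thesis by (simp add: Ext_def)
qed

lemma Surv_eq: "Surv M N X z = {\<omega> \<in> space M. \<forall>n. 1 \<le> contam N X z n \<omega>}"
  unfolding Surv_def Ext_eq set_eq_iff by (simp add: Suc_le_eq) blast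

lemma contam_superadditive:
  assumes F: "F \<subseteq> gen N \<omega> n" and y: "\<And>v. v \<in> F \<Longrightarrow> y \<le> Zp N X z v \<omega>"
  shows "(\<Sum>v\<in>F. contam (\<lambda>u. N (u @ v)) (\<lambda>k i u. X k i (u @ v)) y m \<omega>) \<le> contam N X z (n + m) \<omega>"
proof -
  define S where "S v = infected (\<lambda>u. N (u @ v)) (\<lambda>k i u. X k i (u @ v)) y m \<omega>" for v
  have fin: "finite F" using F by (rule finite_subset) simp
  have "(\<Sum>v\<in>F. contam (\<lambda>u. N (u @ v)) (\<lambda>k i u. X k i (u @ v)) y m \<omega>)
      = card (SIGMA v:F. S v)"
    using fin by (simp add: contam_eq_card_infected S_def card_SigmaI)
  also have "\<dots> = card ((\<lambda>(v, u). u @ v) ` (SIGMA v:F. S v))"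
  proof (rule card_image[symmetric], rule inj_onI)
    fix p q assume "p \<in> Sigma F S" "q \<in> Sigma F S" and eq: "(case p of (v, u) \<Rightarrow> u @ v) = (case q of (v, u) \<Rightarrow> u @ v)"
    then have "length (snd p) = m" "length (snd q) = m"
      by (auto simp: S_def infected_def gen_def)
    with eq show "p = q" by (auto split: prod.splits)
  qed
  also have "\<dots> \<le> card (infected N X z (n + m) \<omega>)"
  proof (rule card_mono)
    show "(\<lambda>(v, u). u @ v) ` Sigma F S \<subseteq> infected N X z (n + m) \<omega>"
      using F by (auto simp: S_def infected_def gen_def in_tree_append
          intro: less_le_trans[OF _ Zp_mono_append[OF y]])
  qed simp
  finally show ?thesis by (simp add: contam_eq_card_infected)
qed

lemma
  assumes "v \<in> UH" "length v \<le> n"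
    and N: "\<And>u. u \<in> UH \<Longrightarrow> length u < n \<Longrightarrow> N u \<omega> = N' u \<omega>'"
  shows in_tree_cong: "in_tree N \<omega> v \<longleftrightarrow> in_tree N' \<omega>' v"
    and Zp_cong: "(\<And>k i u. 1 \<le> k \<Longrightarrow> 1 \<le> i \<Longrightarrow> u \<in> UH \<Longrightarrow> length u < n \<Longrightarrow> X k i u \<omega> = X' k i u \<omega>') \<Longrightarrow>
      Zp N X z v \<omega> = Zp N' X' z v \<omega>'"
  using assms(1,2) by (induction v) (auto simp: N intro!: sum.cong)

lemma infected_cong:
  assumes N: "\<And>u. u \<in> UH \<Longrightarrow> length u < n \<Longrightarrow> N u \<omega> = N' u \<omega>'"
    and X: "\<And>k i u. 1 \<le> k \<Longrightarrow> 1 \<le> i \<Longrightarrow> u \<in> UH \<Longrightarrow> length u < n \<Longrightarrow> X k i u \<omega> = X' k i u \<omega>'"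
  shows "infected N X z n \<omega> = infected N' X' z n \<omega>'"
proof -
  have "v \<in> infected N X z n \<omega> \<longleftrightarrow> v \<in> infected N' X' z n \<omega>'" if "v \<in> UH" for v
    using in_tree_cong[of v n N \<omega> N' \<omega>'] Zp_cong[of v n N \<omega> N' \<omega>' X X' z] that N X
    by (auto simp: infected_def gen_def)
  moreover have "v \<in> UH" if "v \<in> infected N X z n \<omega> \<or> v \<in> infected N' X' z n \<omega>'" for v
    using that by (auto dest: subsetD[OF infected_subset_UH])
  ultimately show ?thesis by blast
qed

lemma Zp_measurable:
  assumes N: "\<And>v. v \<in> UH \<Longrightarrow> N v \<in> M \<rightarrow>\<^sub>M count_space UNIV"
    and X: "\<And>k i v. 1 \<le> k \<Longrightarrow> 1 \<le> i \<Longrightarrow> v \<in> UH \<Longrightarrow> X k i v \<in> M \<rightarrow>\<^sub>M count_space UNIV"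
  shows "v \<in> UH \<Longrightarrow> Zp N X z v \<in> M \<rightarrow>\<^sub>M count_space UNIV"
proof (induction v)
  case Nil
  then show ?case by simp
next
  case (Cons j v)
  define f where "f = (\<lambda>k m \<omega>. if 1 \<le> j \<and> j \<le> k then \<Sum>i = 1..m. X k i v \<omega> ! (j - 1) else 0)"
  have "f k m \<in> M \<rightarrow>\<^sub>M count_space UNIV" for k m
  proof (cases "1 \<le> j \<and> j \<le> k")
    case True
    have "(\<lambda>\<omega>. X k i v \<omega> ! (j - 1)) \<in> M \<rightarrow>\<^sub>M count_space UNIV" if "i \<in> {1..m}" for i
      using X[of k i v] True that Cons by (auto intro: measurable_compose)
    with True show ?thesis unfolding f_def by (simp add: measurable_sum_nat)
  next
    case False
    then show ?thesis unfolding f_def if_not_P[OF False] by simp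
  qed
  then have "(\<lambda>\<omega>. f k (Zp N X z v \<omega>) \<omega>) \<in> M \<rightarrow>\<^sub>M count_space UNIV" for k
    by (rule measurable_compose_countable[where f = "f k"]) (use Cons in simp)
  then have "(\<lambda>\<omega>. f (N v \<omega>) (Zp N X z v \<omega>) \<omega>) \<in> M \<rightarrow>\<^sub>M count_space UNIV"
    by (rule measurable_compose_countable[where f = "\<lambda>k \<omega>. f k (Zp N X z v \<omega>) \<omega>"])
      (use N Cons in simp)
  then show ?case by (simp add: f_def)
qed

lemma infected_measurable:
  assumes N: "\<And>v. v \<in> UH \<Longrightarrow> N v \<in> M \<rightarrow>\<^sub>M count_space UNIV"
    and X: "\<And>k i v. 1 \<le> k \<Longrightarrow> 1 \<le> i \<Longrightarrow> v \<in> UH \<Longrightarrow> X k i v \<in> M \<rightarrow>\<^sub>M count_space UNIV"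
  shows "infected N X z n \<in> M \<rightarrow>\<^sub>M count_space {F. finite F}"
proof -
  have tree: "Measurable.pred M (\<lambda>\<omega>. in_tree N \<omega> v)" if "v \<in> UH" for v
    using that
  proof (induction v)
    case (Cons j v)
    note [measurable] = N[of v]
    from Cons show ?case by simp
  qed simp
  have mem: "Measurable.pred M (\<lambda>\<omega>. v \<in> infected N X z n \<omega>)" for v
  proof (cases "v \<in> UH")
    case True
    note [measurable] = tree[OF True] Zp_measurable[OF N X True, where z = z]
    show ?thesis unfolding infected_def gen_def by simp
  next
    case False
    then have "v \<notin> infected N X z n \<omega>" for \<omega> using infected_subset_UH by fast
    then show ?thesis by simp
  qed
  show ?thesis
  proof (subst measurable_count_space_eq_countable, rule countable_Collect_finite, safe)
    fix F :: "nat list set"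
    have "infected N X z n -` {F} \<inter> space M
        = {\<omega> \<in> space M. \<forall>v. v \<in> infected N X z n \<omega> \<longleftrightarrow> v \<in> F}" by auto
    also have "\<dots> \<in> sets M" using mem by measurable
    finally show "infected N X z n -` {F} \<inter> space M \<in> sets M" .
  qed simp
qed

lemma contam_measurable:
  assumes N: "\<And>v. v \<in> UH \<Longrightarrow> N v \<in> M \<rightarrow>\<^sub>M count_space UNIV"
    and X: "\<And>k i v. 1 \<le> k \<Longrightarrow> 1 \<le> i \<Longrightarrow> v \<in> UH \<Longrightarrow> X k i v \<in> M \<rightarrow>\<^sub>M count_space UNIV"
  shows "contam N X z n \<in> M \<rightarrow>\<^sub>M count_space UNIV"
  using measurable_compose[OF infected_measurable[of N M X z n, OF N X], of card "count_space UNIV"]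
  by (simp add: contam_eq_card_infected[abs_def])

section \<open>The branching property\<close>

type_synonym index = "nat list + nat \<times> nat \<times> nat list"

definition idx :: "index set" where
  "idx = Inl ` UH \<union> Inr ` {(k, i, v). 1 \<le> k \<and> 1 \<le> i \<and> v \<in> UH}"

fun cell :: "index \<Rightarrow> nat list" where
  "cell (Inl v) = v"
| "cell (Inr (k, i, v)) = v"

fun reroot :: "nat list \<Rightarrow> index \<Rightarrow> index" where
  "reroot v (Inl u) = Inl (u @ v)"
| "reroot v (Inr (k, i, u)) = Inr (k, i, u @ v)"

definition idx_below :: "nat \<Rightarrow> index set" where
  "idx_below n = {a \<in> idx. length (cell a) < n}"

abbreviation PS :: "index set \<Rightarrow> (index \<Rightarrow> nat + nat list) measure" where
  "PS K \<equiv> \<Pi>\<^sub>M a\<in>K. count_space UNIV"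

text \<open>The coordinate versions of N and X on the space of all observation families: the process
  is a function of the observations, so equality in law of observations transfers to it.\<close>

definition coordN :: "nat list \<Rightarrow> (index \<Rightarrow> nat + nat list) \<Rightarrow> nat" where
  "coordN v f = projl (f (Inl v))"

definition coordX :: "nat \<Rightarrow> nat \<Rightarrow> nat list \<Rightarrow> (index \<Rightarrow> nat + nat list) \<Rightarrow> nat list" where
  "coordX k i v f = projr (f (Inr (k, i, v)))"

lemma Inl_in_idx [simp]: "Inl v \<in> idx \<longleftrightarrow> v \<in> UH"
  by (auto simp: idx_def)

lemma Inr_in_idx [simp]: "Inr (k, i, v) \<in> idx \<longleftrightarrow> 1 \<le> k \<and> 1 \<le> i \<and> v \<in> UH"
  by (auto simp: idx_def)

lemma reroot_in_idx: "v \<in> UH \<Longrightarrow> a \<in> idx \<Longrightarrow> reroot v a \<in> idx"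
  by (cases a rule: cell.cases) auto

lemma inj_reroot: "inj (reroot v)"
proof (rule injI)
  fix a b assume "reroot v a = reroot v b"
  then show "a = b" by (cases a rule: cell.cases; cases b rule: cell.cases) auto
qed

lemma cell_reroot [simp]: "cell (reroot v a) = cell a @ v"
  by (cases a rule: cell.cases) auto

lemma component_measurable: "(\<lambda>f. f a) \<in> PS K \<rightarrow>\<^sub>M count_space UNIV"
proof (cases "a \<in> K")
  case False
  then have "(\<lambda>f. f a) \<in> PS K \<rightarrow>\<^sub>M count_space UNIV \<longleftrightarrow> (\<lambda>f. undefined :: nat + nat list) \<in> PS K \<rightarrow>\<^sub>M count_space UNIV"
    by (intro measurable_cong) (auto simp: space_PiM PiE_def extensional_def)
  then show ?thesis by simp
qed (rule measurable_component_singleton)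

lemma coordN_measurable [measurable]: "coordN v \<in> PS K \<rightarrow>\<^sub>M count_space UNIV"
  unfolding coordN_def by (rule measurable_compose[OF component_measurable]) auto

lemma coordX_measurable [measurable]: "coordX k i v \<in> PS K \<rightarrow>\<^sub>M count_space UNIV"
  unfolding coordX_def by (rule measurable_compose[OF component_measurable]) auto

lemmas contam_coord_measurable [measurable] =
  contam_measurable[of coordN "PS K" coordX for K, OF coordN_measurable coordX_measurable]
lemmas infected_coord_measurable [measurable] =
  infected_measurable[of coordN "PS K" coordX for K, OF coordN_measurable coordX_measurable]

locale bwbp = prob_space M for M :: "'a measure" +
  fixes N :: "nat list \<Rightarrow> 'a \<Rightarrow> nat"
    and X :: "nat \<Rightarrow> nat \<Rightarrow> nat list \<Rightarrow> 'a \<Rightarrow> nat list"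
  assumes model: "bwbp_model M N X"
begin

definition obs :: "index \<Rightarrow> 'a \<Rightarrow> nat + nat list" where
  "obs = (\<lambda>a \<omega>. case a of Inl v \<Rightarrow> Inl (N v \<omega>) | Inr (k, i, v) \<Rightarrow> Inr (X k i v \<omega>))"

lemma indep_obs: "indep_vars (\<lambda>_. count_space UNIV) obs idx"
  using model unfolding bwbp_model_def obs_def idx_def by blast

lemma obs_measurable: "a \<in> idx \<Longrightarrow> obs a \<in> M \<rightarrow>\<^sub>M count_space UNIV"
  using indep_obs by (auto simp: indep_vars_def)

lemma N_measurable: "v \<in> UH \<Longrightarrow> N v \<in> M \<rightarrow>\<^sub>M count_space UNIV"
  using measurable_compose[OF obs_measurable[of "Inl v"], of projl "count_space UNIV"]
  by (simp add: obs_def)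

lemma X_measurable: "1 \<le> k \<Longrightarrow> 1 \<le> i \<Longrightarrow> v \<in> UH \<Longrightarrow> X k i v \<in> M \<rightarrow>\<^sub>M count_space UNIV"
  using measurable_compose[OF obs_measurable[of "Inr (k, i, v)"], of projr "count_space UNIV"]
  by (simp add: obs_def)

lemmas contam_M [measurable] = contam_measurable[of N M X, OF N_measurable X_measurable]
lemmas infected_M [measurable] = infected_measurable[of N M X, OF N_measurable X_measurable]

lemma distr_obs_reroot:
  assumes "v \<in> UH" "a \<in> idx"
  shows "distr M (count_space UNIV) (obs (reroot v a)) = distr M (count_space UNIV) (obs a)"
proof (cases a rule: cell.cases)
  case (1 u)
  have "distr M (count_space UNIV) (obs (Inl w)) =
      distr (distr M (count_space UNIV) (N [])) (count_space UNIV) Inl" if w: "w \<in> UH" for w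
  proof -
    have "obs (Inl w) = Inl \<circ> N w" by (simp add: obs_def comp_def)
    moreover have "distr (distr M (count_space UNIV) (N w)) (count_space UNIV) Inl
        = distr M (count_space UNIV) (Inl \<circ> N w)"
      by (rule distr_distr[OF _ N_measurable[OF w]]) simp
    moreover have "distr M (count_space UNIV) (N w) = distr M (count_space UNIV) (N [])"
      using w model unfolding bwbp_model_def by blast
    ultimately show ?thesis by metis
  qed
  with 1 assms show ?thesis by simp
next
  case (2 k i u)
  then have k: "1 \<le> k" "1 \<le> i" using assms by auto
  have "distr M (count_space UNIV) (obs (Inr (k, i, w))) =
      distr (distr M (count_space UNIV) (X k 1 [])) (count_space UNIV) Inr" if w: "w \<in> UH" for w
  proof -
    have "obs (Inr (k, i, w)) = Inr \<circ> X k i w" by (simp add: obs_def comp_def)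
    moreover have "distr (distr M (count_space UNIV) (X k i w)) (count_space UNIV) Inr
        = distr M (count_space UNIV) (Inr \<circ> X k i w)"
      by (rule distr_distr[OF _ X_measurable[OF k w]]) simp
    moreover have "distr M (count_space UNIV) (X k i w) = distr M (count_space UNIV) (X k 1 [])"
      using w k model unfolding bwbp_model_def by blast
    ultimately show ?thesis by metis
  qed
  with 2 assms show ?thesis by simp
qed

definition past :: "nat \<Rightarrow> 'a \<Rightarrow> index \<Rightarrow> nat + nat list" where
  "past n \<omega> = (\<lambda>a\<in>idx_below n. obs a \<omega>)"

definition subtree :: "nat list \<Rightarrow> 'a \<Rightarrow> index \<Rightarrow> nat + nat list" where
  "subtree v \<omega> = (\<lambda>a\<in>idx. obs (reroot v a) \<omega>)"

lemma subtree_measurable: "v \<in> UH \<Longrightarrow> subtree v \<in> M \<rightarrow>\<^sub>M PS idx"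
  unfolding subtree_def by (intro measurable_restrict obs_measurable reroot_in_idx)

lemma distr_subtree:
  assumes v: "v \<in> UH"
  shows "distr M (PS idx) (subtree v) = distr M (PS idx) (subtree [])"
proof -
  define D where "D = (\<lambda>a. distr M (count_space UNIV) (obs a))"
  have nonempty: "idx \<noteq> {}" by (metis Inl_in_idx Nil_in_UH empty_iff)
  have "distr M (PS idx) (subtree v) = PiM idx D" if v: "v \<in> UH" for v
  proof -
    have reindex: "(\<lambda>f. \<lambda>a\<in>idx. f (reroot v a)) \<in> PS idx \<rightarrow>\<^sub>M PS idx"
      using v by (intro measurable_restrict measurable_component_singleton reroot_in_idx)
    have "distr M (PS idx) (\<lambda>\<omega>. \<lambda>a\<in>idx. obs a \<omega>) = PiM idx D"
      unfolding D_def using indep_obs nonempty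
      by (subst (asm) indep_vars_iff_distr_eq_PiM') (auto intro: obs_measurable)
    then have "distr (PiM idx D) (PS idx) (\<lambda>f. \<lambda>a\<in>idx. f (reroot v a))
        = distr (distr M (PS idx) (\<lambda>\<omega>. \<lambda>a\<in>idx. obs a \<omega>)) (PS idx) (\<lambda>f. \<lambda>a\<in>idx. f (reroot v a))"
      by simp
    also have "\<dots> = distr M (PS idx) ((\<lambda>f. \<lambda>a\<in>idx. f (reroot v a)) \<circ> (\<lambda>\<omega>. \<lambda>a\<in>idx. obs a \<omega>))"
      by (rule distr_distr[OF reindex]) (intro measurable_restrict obs_measurable)
    also have "(\<lambda>f. \<lambda>a\<in>idx. f (reroot v a)) \<circ> (\<lambda>\<omega>. \<lambda>a\<in>idx. obs a \<omega>) = subtree v"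
      using v by (auto simp: subtree_def fun_eq_iff reroot_in_idx)
    finally have "distr M (PS idx) (subtree v) = distr (PiM idx D) (PS idx) (\<lambda>f. \<lambda>a\<in>idx. f (reroot v a))" ..
    also have "\<dots> = distr (PiM idx D) (\<Pi>\<^sub>M a\<in>idx. D (reroot v a)) (\<lambda>f. \<lambda>a\<in>idx. f (reroot v a))"
      by (intro distr_cong sets_PiM_cong) (auto simp: D_def)
    also have "\<dots> = (\<Pi>\<^sub>M a\<in>idx. D (reroot v a))"
      using v by (intro distr_PiM_reindex)
        (auto simp: D_def intro: prob_space_distr obs_measurable inj_on_subset[OF inj_reroot] reroot_in_idx)
    also have "\<dots> = PiM idx D"
      using v by (intro PiM_cong) (auto simp: D_def distr_obs_reroot)
    finally show ?thesis .
  qed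
  from this[OF v] this[of "[]"] show ?thesis by simp
qed

lemma prob_subtree:
  assumes v: "v \<in> UH" and H: "H \<in> sets (PS idx)"
  shows "prob {\<omega> \<in> space M. subtree v \<omega> \<in> H} = prob {\<omega> \<in> space M. subtree [] \<omega> \<in> H}"
proof -
  have "prob {\<omega> \<in> space M. subtree u \<omega> \<in> H} = measure (distr M (PS idx) (subtree u)) H" if "u \<in> UH" for u
    using measure_distr[OF subtree_measurable[OF that] H] by (simp add: vimage_def Int_def conj_commute)
  from this[OF v] this[of "[]"] show ?thesis by (simp add: distr_subtree[OF v])
qed

lemma branching_property:
  assumes F: "F \<subseteq> {v \<in> UH. length v = n}" "finite F"
    and E: "E \<in> sets (PS (idx_below n))" and H: "H \<in> sets (PS idx)"
  shows "prob {\<omega> \<in> space M. past n \<omega> \<in> E \<and> (\<forall>v\<in>F. subtree v \<omega> \<in> H)}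
    = prob {\<omega> \<in> space M. past n \<omega> \<in> E}
      * prob {\<omega> \<in> space M. subtree [] \<omega> \<in> H} ^ card F"
proof -
  define K where "K = case_option (idx_below n) (\<lambda>v. reroot v ` idx)"
  define L where "L = insert None (Some ` F)"
  define R where "R = (\<lambda>j \<omega>. restrict (\<lambda>a. obs a \<omega>) (K j))"
  define A where "A = case_option E (\<lambda>v. {f \<in> space (PS (reroot v ` idx)). (\<lambda>a\<in>idx. f (reroot v a)) \<in> H})"
  have K_sub: "K j \<subseteq> idx" if "j \<in> L" for j
    using that F by (auto simp: K_def L_def idx_below_def intro!: reroot_in_idx)
  have disj: "disjoint_family_on K L"
  proof -
    have "u = v" if "reroot u a = reroot v b" "u \<in> F" "v \<in> F" for u v a b
    proof -
      have "cell a @ u = cell b @ v" using that(1) by (metis cell_reroot)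
      moreover have "length u = length v" using that F by auto
      ultimately show ?thesis by simp
    qed
    moreover have "reroot v a \<notin> idx_below n" if "v \<in> F" for v a
      using that F by (auto simp: idx_below_def)
    ultimately show ?thesis
      by (auto simp: disjoint_family_on_def K_def L_def)
  qed
  have indep: "indep_vars (\<lambda>j. PS (K j)) R L"
    unfolding R_def by (rule indep_vars_restrict[OF indep_obs K_sub disj])
  have A: "A j \<in> sets (PS (K j))" if "j \<in> L" for j
  proof (cases j)
    case (Some v)
    have "(\<lambda>f. \<lambda>a\<in>idx. f (reroot v a)) \<in> PS (reroot v ` idx) \<rightarrow>\<^sub>M PS idx"
      by (intro measurable_restrict measurable_component_singleton) auto
    from measurable_sets[OF this H] Some show ?thesis
      by (simp add: A_def K_def vimage_def Int_def conj_commute)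
  qed (use E in \<open>simp add: A_def K_def\<close>)
  have R_None: "R None -` A None \<inter> space M = {\<omega> \<in> space M. past n \<omega> \<in> E}"
    by (auto simp: R_def A_def K_def past_def)
  have R_Some: "R (Some v) -` A (Some v) \<inter> space M = {\<omega> \<in> space M. subtree v \<omega> \<in> H}" for v
  proof -
    have "(\<lambda>a\<in>idx. R (Some v) \<omega> (reroot v a)) = subtree v \<omega>" for \<omega>
      by (auto simp: R_def K_def subtree_def fun_eq_iff)
    then show ?thesis by (auto simp: A_def space_PiM PiE_def R_def K_def)
  qed
  have "prob (\<Inter>j\<in>L. R j -` A j \<inter> space M) = (\<Prod>j\<in>L. prob (R j -` A j \<inter> space M))"
    using F by (intro indep_varsD_finite[OF indep] A) (auto simp: L_def)
  also have "(\<Inter>j\<in>L. R j -` A j \<inter> space M) =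
      {\<omega> \<in> space M. past n \<omega> \<in> E \<and> (\<forall>v\<in>F. subtree v \<omega> \<in> H)}"
    unfolding L_def INT_insert INT_simps(10) by (auto simp: R_None R_Some)
  also have "(\<Prod>j\<in>L. prob (R j -` A j \<inter> space M)) =
      prob (R None -` A None \<inter> space M) * (\<Prod>v\<in>F. prob (R (Some v) -` A (Some v) \<inter> space M))"
    using F by (simp add: L_def prod.reindex)
  also have "(\<Prod>v\<in>F. prob (R (Some v) -` A (Some v) \<inter> space M)) =
      (\<Prod>v\<in>F. prob {\<omega> \<in> space M. subtree [] \<omega> \<in> H})"
    using F by (intro prod.cong refl) (simp add: R_Some, rule prob_subtree[OF _ H], auto)
  finally show ?thesis unfolding R_None by (simp only: prod_constant)
qed

end

section \<open>Events that recur with a chance of escape\<close>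

context prob_space
begin

lemma prob_ge_countable_cases:
  assumes S: "S \<in> M \<rightarrow>\<^sub>M count_space C" and C: "countable C"
    and E [measurable]: "E \<in> events" and B [measurable]: "B \<in> events" and c: "0 \<le> c"
    and le: "\<And>s. s \<in> C \<Longrightarrow> c * prob {\<omega> \<in> E. S \<omega> = s} \<le> prob {\<omega> \<in> E \<inter> B. S \<omega> = s}"
  shows "c * prob E \<le> prob (E \<inter> B)"
proof -
  have S_in: "S \<omega> \<in> C" if "\<omega> \<in> space M" for \<omega>
    using measurable_space[OF S that] by simp
  have meas: "{\<omega> \<in> A. S \<omega> = s} \<in> events" if "A \<in> events" "s \<in> C" for A s
  proof -
    have "{\<omega> \<in> A. S \<omega> = s} = A \<inter> (S -` {s} \<inter> space M)"
      using sets.sets_into_space[OF that(1)] by auto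
    then show ?thesis using that measurable_sets[OF S, of "{s}"] by auto
  qed
  have split: "emeasure M A = (\<integral>\<^sup>+s. emeasure M {\<omega> \<in> A. S \<omega> = s} \<partial>count_space C)"
    if A: "A \<in> events" for A
  proof -
    have "A = (\<Union>s\<in>C. {\<omega> \<in> A. S \<omega> = s})"
      using sets.sets_into_space[OF A] S_in by auto
    moreover have "emeasure M (\<Union>s\<in>C. {\<omega> \<in> A. S \<omega> = s})
        = (\<integral>\<^sup>+s. emeasure M {\<omega> \<in> A. S \<omega> = s} \<partial>count_space C)"
      by (intro emeasure_UN_countable meas A C) (auto simp: disjoint_family_on_def)
    ultimately show ?thesis by simp
  qed
  have "ennreal c * emeasure M E = (\<integral>\<^sup>+s. ennreal c * emeasure M {\<omega> \<in> E. S \<omega> = s} \<partial>count_space C)"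
    by (simp add: split[OF E] nn_integral_cmult)
  also have "\<dots> \<le> (\<integral>\<^sup>+s. emeasure M {\<omega> \<in> E \<inter> B. S \<omega> = s} \<partial>count_space C)"
    using le c by (intro nn_integral_mono) (auto simp: emeasure_eq_measure simp flip: ennreal_mult)
  also have "\<dots> = emeasure M (E \<inter> B)"
    by (rule split[symmetric]) simp
  finally show ?thesis
    using c by (simp add: emeasure_eq_measure flip: ennreal_mult)
qed

text \<open>If each first visit to D after time m is, with probability at least c, followed by
  an escape B that rules out infinitely many visits, then the visits after m have
  probability U with c U \<le> U - P(infinitely many visits); let m tend to infinity.\<close>

lemma prob_limsup_eq_0:
  fixes D B :: "nat \<Rightarrow> 'a set" and c :: real
  assumes D [measurable]: "\<And>n. D n \<in> events" and B [measurable]: "\<And>n. B n \<in> events"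
    and c: "0 < c"
    and escape: "\<And>m n. m \<le> n \<Longrightarrow>
      c * prob (D n - \<Union>(D ` {m..<n})) \<le> prob ((D n - \<Union>(D ` {m..<n})) \<inter> B n)"
    and avoid: "\<And>n. B n \<inter> (\<Inter>m. \<Union>k\<in>{m..}. D k) = {}"
  shows "prob (\<Inter>m. \<Union>k\<in>{m..}. D k) = 0"
proof -
  define U where "U m = (\<Union>k\<in>{m..}. D k)" for m
  define A where "A = (\<Inter>m. U m)"
  have U [measurable]: "U m \<in> events" for m unfolding U_def by measurable
  have A [measurable]: "A \<in> events" unfolding A_def by measurable
  have A_sub: "A \<subseteq> U m" for m by (auto simp: A_def)
  have bound: "c * prob (U m) \<le> prob (U m) - prob A" for m
  proof -
    define T where "T \<omega> = (LEAST n. m \<le> n \<and> \<omega> \<in> D n)" for \<omega>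
    have T [measurable]: "T \<in> M \<rightarrow>\<^sub>M count_space UNIV" unfolding T_def by measurable
    have T_eq: "{\<omega> \<in> U m. T \<omega> = n} = (if m \<le> n then D n - \<Union>(D ` {m..<n}) else {})" for n
    proof -
      have "\<omega> \<in> U m \<and> T \<omega> = n \<longleftrightarrow> m \<le> n \<and> \<omega> \<in> D n \<and> (\<forall>k. m \<le> k \<and> k < n \<longrightarrow> \<omega> \<notin> D k)" for \<omega>
      proof
        assume *: "\<omega> \<in> U m \<and> T \<omega> = n"
        then have "\<exists>n. m \<le> n \<and> \<omega> \<in> D n" by (auto simp: U_def)
        from LeastI_ex[OF this] * show "m \<le> n \<and> \<omega> \<in> D n \<and> (\<forall>k. m \<le> k \<and> k < n \<longrightarrow> \<omega> \<notin> D k)"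
          unfolding T_def using not_less_Least by blast
      next
        assume *: "m \<le> n \<and> \<omega> \<in> D n \<and> (\<forall>k. m \<le> k \<and> k < n \<longrightarrow> \<omega> \<notin> D k)"
        then have "T \<omega> = n" unfolding T_def by (intro Least_equality) (auto simp: not_less[symmetric])
        with * show "\<omega> \<in> U m \<and> T \<omega> = n" by (auto simp: U_def)
      qed
      then show ?thesis by auto
    qed
    have "c * prob (U m) \<le> prob (U m \<inter> (space M - A))"
    proof (rule prob_ge_countable_cases[OF T])
      fix n
      show "c * prob {\<omega> \<in> U m. T \<omega> = n} \<le> prob {\<omega> \<in> U m \<inter> (space M - A). T \<omega> = n}"
      proof (cases "m \<le> n")
        case True
        have "c * prob {\<omega> \<in> U m. T \<omega> = n} \<le> prob ({\<omega> \<in> U m. T \<omega> = n} \<inter> B n)"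
          using escape[OF True] True by (simp add: T_eq)
        also have "\<dots> \<le> prob {\<omega> \<in> U m \<inter> (space M - A). T \<omega> = n}"
        proof (rule finite_measure_mono)
          show "{\<omega> \<in> U m. T \<omega> = n} \<inter> B n \<subseteq> {\<omega> \<in> U m \<inter> (space M - A). T \<omega> = n}"
            using avoid[of n] sets.sets_into_space[OF U, of m] unfolding A_def U_def by blast
          have "{\<omega> \<in> U m \<inter> (space M - A). T \<omega> = n} = {\<omega> \<in> U m. T \<omega> = n} - A"
            using sets.sets_into_space[OF U] by auto
          then show "{\<omega> \<in> U m \<inter> (space M - A). T \<omega> = n} \<in> events"
            by (auto simp: T_eq)
        qed
        finally show ?thesis .
      qed (simp add: T_eq)
    qed (use c in auto)
    also have "U m \<inter> (space M - A) = U m - A" using sets.sets_into_space[OF U] by auto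
    also have "prob (U m - A) = prob (U m) - prob A"
      by (rule finite_measure_Diff) (use A_sub in auto)
    finally show ?thesis .
  qed
  have lim: "(\<lambda>m. prob (U m)) \<longlonglongrightarrow> prob A"
    unfolding A_def by (rule finite_Lim_measure_decseq) (auto simp: decseq_def U_def intro: order_trans)
  have "c * prob A \<le> prob A - prob A"
    by (rule LIMSEQ_le[OF tendsto_mult_left[OF lim] tendsto_diff[OF lim tendsto_const]])
      (use bound in auto)
  with c have "prob A = 0" by (simp add: mult_le_0_iff measure_le_0_iff)
  then show ?thesis by (simp add: A_def U_def)
qed

end

context bwbp
begin

lemma past_measurable [measurable]: "past n \<in> M \<rightarrow>\<^sub>M PS (idx_below n)"
  unfolding past_def by (intro measurable_restrict obs_measurable) (simp add: idx_below_def)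

lemma contam_subtree:
  "v \<in> UH \<Longrightarrow> contam (\<lambda>u. N (u @ v)) (\<lambda>k i u. X k i (u @ v)) z m \<omega> = contam coordN coordX z m (subtree v \<omega>)"
  unfolding contam_eq_card_infected
  by (intro arg_cong[of _ _ card] infected_cong) (auto simp: coordN_def coordX_def subtree_def obs_def)

lemma infected_past:
  "m \<le> n \<Longrightarrow> infected N X z m \<omega> = infected coordN coordX z m (past n \<omega>)"
  by (intro infected_cong) (auto simp: coordN_def coordX_def past_def obs_def idx_below_def)

lemma contam_past:
  "m \<le> n \<Longrightarrow> contam N X z m \<omega> = contam coordN coordX z m (past n \<omega>)"
  by (simp add: contam_eq_card_infected infected_past)

lemma contam_branching:
  assumes F: "F \<subseteq> {v \<in> UH. length v = n}" "finite F"
    and E: "E \<in> sets (PS (idx_below n))"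
    and root: "\<And>\<omega>. \<omega> \<in> space M \<Longrightarrow> past n \<omega> \<in> E \<Longrightarrow> F \<subseteq> gen N \<omega> n \<and> (\<forall>v\<in>F. y \<le> Zp N X z v \<omega>)"
  shows "prob {\<omega> \<in> space M. past n \<omega> \<in> E} * prob {\<omega> \<in> space M. \<forall>m. l m \<le> contam N X y m \<omega>} ^ card F
    \<le> prob {\<omega> \<in> space M. past n \<omega> \<in> E \<and> (\<forall>m. card F * l m \<le> contam N X z (n + m) \<omega>)}"
proof -
  define H where "H = {f \<in> space (PS idx). \<forall>m. l m \<le> contam coordN coordX y m f}"
  have H: "H \<in> sets (PS idx)" unfolding H_def by measurable
  have in_H: "subtree v \<omega> \<in> H \<longleftrightarrow> (\<forall>m. l m \<le> contam (\<lambda>u. N (u @ v)) (\<lambda>k i u. X k i (u @ v)) y m \<omega>)"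
    if "v \<in> UH" "\<omega> \<in> space M" for v \<omega>
    using measurable_space[OF subtree_measurable that(2)] that by (simp add: H_def contam_subtree)
  have "prob {\<omega> \<in> space M. past n \<omega> \<in> E} * prob {\<omega> \<in> space M. \<forall>m. l m \<le> contam N X y m \<omega>} ^ card F
      = prob {\<omega> \<in> space M. past n \<omega> \<in> E} * prob {\<omega> \<in> space M. subtree [] \<omega> \<in> H} ^ card F"
    using in_H[of "[]"] by (simp cong: conj_cong)
  also have "\<dots> = prob {\<omega> \<in> space M. past n \<omega> \<in> E \<and> (\<forall>v\<in>F. subtree v \<omega> \<in> H)}"
    by (rule branching_property[OF F E H, symmetric])
  also have "\<dots> \<le> prob {\<omega> \<in> space M. past n \<omega> \<in> E \<and> (\<forall>m. card F * l m \<le> contam N X z (n + m) \<omega>)}"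
  proof (rule finite_measure_mono)
    show "{\<omega> \<in> space M. past n \<omega> \<in> E \<and> (\<forall>m. card F * l m \<le> contam N X z (n + m) \<omega>)} \<in> events"
      using E by measurable
    show "{\<omega> \<in> space M. past n \<omega> \<in> E \<and> (\<forall>v\<in>F. subtree v \<omega> \<in> H)}
        \<subseteq> {\<omega> \<in> space M. past n \<omega> \<in> E \<and> (\<forall>m. card F * l m \<le> contam N X z (n + m) \<omega>)}"
    proof clarify
      fix \<omega> m assume \<omega>: "\<omega> \<in> space M" "past n \<omega> \<in> E" and sub: "\<forall>v\<in>F. subtree v \<omega> \<in> H"
      have "card F * l m = (\<Sum>v\<in>F. l m)" by simp
      also have "\<dots> \<le> (\<Sum>v\<in>F. contam (\<lambda>u. N (u @ v)) (\<lambda>k i u. X k i (u @ v)) y m \<omega>)"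
        using sub F \<omega> in_H by (intro sum_mono) blast
      also have "\<dots> \<le> contam N X z (n + m) \<omega>"
        using root[OF \<omega>] by (intro contam_superadditive) auto
      finally show "card F * l m \<le> contam N X z (n + m) \<omega>" .
    qed
  qed
  finally show ?thesis .
qed

lemma prob_obs_prod:
  assumes "J \<noteq> {}" "finite J" "J \<subseteq> idx"
  shows "prob {\<omega> \<in> space M. \<forall>a\<in>J. obs a \<omega> \<in> A a} = (\<Prod>a\<in>J. prob {\<omega> \<in> space M. obs a \<omega> \<in> A a})"
proof -
  have "prob (\<Inter>a\<in>J. obs a -` A a \<inter> space M) = (\<Prod>a\<in>J. prob (obs a -` A a \<inter> space M))"
    by (rule indep_varsD[OF indep_obs assms]) simp
  moreover have "(\<Inter>a\<in>J. obs a -` A a \<inter> space M) = {\<omega> \<in> space M. \<forall>a\<in>J. obs a \<omega> \<in> A a}"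
    using assms by auto
  moreover have "obs a -` A a \<inter> space M = {\<omega> \<in> space M. obs a \<omega> \<in> A a}" for a
    by auto
  ultimately show ?thesis by simp
qed

lemma prob_N:
  assumes "v \<in> UH"
  shows "prob {\<omega> \<in> space M. N v \<omega> = k} = prob {\<omega> \<in> space M. N [] \<omega> = k}"
proof -
  have *: "prob {\<omega> \<in> space M. N u \<omega> = k} = measure (distr M (count_space UNIV) (N u)) {k}" if "u \<in> UH" for u
    by (subst measure_distr[OF N_measurable[OF that]]) (auto intro!: arg_cong[of _ _ prob])
  have "distr M (count_space UNIV) (N v) = distr M (count_space UNIV) (N [])"
    using assms model unfolding bwbp_model_def by blast
  with *[OF assms] *[of "[]"] show ?thesis by simp
qed

lemma prob_X:
  assumes "1 \<le> k" "1 \<le> i" "v \<in> UH"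
  shows "prob {\<omega> \<in> space M. P (X k i v \<omega>)} = prob {\<omega> \<in> space M. P (X k 1 [] \<omega>)}"
proof -
  have *: "prob {\<omega> \<in> space M. P (X k i u \<omega>)} = measure (distr M (count_space UNIV) (X k i u)) (Collect P)"
    if "u \<in> UH" "1 \<le> i" for u i
    by (subst measure_distr[OF X_measurable[OF assms(1) that(2,1)]]) (auto intro!: arg_cong[of _ _ prob])
  have "distr M (count_space UNIV) (X k i v) = distr M (count_space UNIV) (X k 1 [])"
    using assms model unfolding bwbp_model_def by blast
  with *[of v i] *[of "[]" 1] assms show ?thesis by simp
qed

lemma prob_N_X:
  assumes "1 \<le> k" "1 \<le> i" "v \<in> UH"
  shows "prob {\<omega> \<in> space M. N v \<omega> = k \<and> P (X k i v \<omega>)}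
    = prob {\<omega> \<in> space M. N [] \<omega> = k} * prob {\<omega> \<in> space M. P (X k 1 [] \<omega>)}"
  using prob_obs_prod[of "{Inl v, Inr (k, i, v)}"
      "case_sum (\<lambda>_. {Inl k}) (\<lambda>_. {Inr x |x. P x})"] assms prob_N[of v k] prob_X[of k i v P]
  by (simp add: obs_def)

lemma prob_N_X_X:
  assumes "1 \<le> k" "1 \<le> a" "1 \<le> b" "a \<noteq> b" "v \<in> UH"
  shows "prob {\<omega> \<in> space M. N v \<omega> = k \<and> P (X k a v \<omega>) \<and> Q (X k b v \<omega>)}
    = prob {\<omega> \<in> space M. N [] \<omega> = k} * prob {\<omega> \<in> space M. P (X k 1 [] \<omega>)}
      * prob {\<omega> \<in> space M. Q (X k 1 [] \<omega>)}"
  using prob_obs_prod[of "{Inl v, Inr (k, a, v), Inr (k, b, v)}"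
      "case_sum (\<lambda>_. {Inl k}) (\<lambda>(k, i, v). if i = a then {Inr x |x. P x} else {Inr x |x. Q x})"]
    assms prob_N[of v k] prob_X[of k a v P] prob_X[of k b v Q]
  by (simp add: obs_def mult.assoc)

end

section \<open>Growth of the number of contaminated cells\<close>

lemma two_le_contam_1:
  assumes "j \<noteq> j'" "1 \<le> j" "j \<le> N [] \<omega>" "1 \<le> j'" "j' \<le> N [] \<omega>"
    and "a \<in> {1..z}" "0 < X (N [] \<omega>) a [] \<omega> ! (j - 1)"
    and "b \<in> {1..z}" "0 < X (N [] \<omega>) b [] \<omega> ! (j' - 1)"
  shows "2 \<le> contam N X z 1 \<omega>"
proof -
  have daughter: "[i] \<in> infected N X z 1 \<omega>"
    if "1 \<le> i" "i \<le> N [] \<omega>" "c \<in> {1..z}" "0 < X (N [] \<omega>) c [] \<omega> ! (i - 1)" for i c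
  proof -
    have "X (N [] \<omega>) c [] \<omega> ! (i - 1) \<le> (\<Sum>c = 1..z. X (N [] \<omega>) c [] \<omega> ! (i - 1))"
      using that by (intro member_le_sum) auto
    with that show ?thesis by (simp add: infected_def gen_def)
  qed
  have "{[j], [j']} \<subseteq> infected N X z 1 \<omega>"
    using daughter[OF assms(2,3,6,7)] daughter[OF assms(4,5,8,9)] by simp
  from card_mono[OF _ this] show ?thesis using assms(1) by (simp add: contam_eq_card_infected)
qed

lemma contam_le_1:
  assumes "\<And>v a b j j'. v \<in> UH \<Longrightarrow> 1 \<le> a \<Longrightarrow> 1 \<le> b \<Longrightarrow> j \<noteq> j' \<Longrightarrow> j \<in> {1..N v \<omega>} \<Longrightarrow> j' \<in> {1..N v \<omega>} \<Longrightarrow>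
      0 < X (N v \<omega>) a v \<omega> ! (j - 1) \<Longrightarrow> 0 < X (N v \<omega>) b v \<omega> ! (j' - 1) \<Longrightarrow> False"
  shows "contam N X z n \<omega> \<le> 1"
proof -
  have "u = v" if "u \<in> infected N X z n \<omega>" "v \<in> infected N X z n \<omega>" for u v
    using that
  proof (induction n arbitrary: u v)
    case 0
    then show ?case by (simp add: infected_def)
  next
    case (Suc n)
    have parent: "\<exists>w\<in>infected N X z n \<omega>. \<exists>j\<in>{1..N w \<omega>}. u = j # w \<and>
        (\<exists>a\<ge>1. 0 < X (N w \<omega>) a w \<omega> ! (j - 1))" if "u \<in> infected N X z (Suc n) \<omega>" for u
    proof -
      from that obtain w j where w: "w \<in> gen N \<omega> n" "j \<in> {1..N w \<omega>}" "u = j # w" "0 < Zp N X z u \<omega>"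
        by (auto simp: infected_def gen_Suc)
      then have pos: "0 < (\<Sum>i = 1..Zp N X z w \<omega>. X (N w \<omega>) i w \<omega> ! (j - 1))" by auto
      then obtain a where "a \<in> {1..Zp N X z w \<omega>}" "0 < X (N w \<omega>) a w \<omega> ! (j - 1)"
        by (metis (no_types, lifting) gr_zeroI less_irrefl sum.neutral)
      with w show ?thesis by (force simp: infected_def)
    qed
    from parent[OF Suc.prems(1)] parent[OF Suc.prems(2)] obtain w j a w' j' b where *:
      "w \<in> infected N X z n \<omega>" "j \<in> {1..N w \<omega>}" "u = j # w" "1 \<le> a" "0 < X (N w \<omega>) a w \<omega> ! (j - 1)"
      "w' \<in> infected N X z n \<omega>" "j' \<in> {1..N w' \<omega>}" "v = j' # w'" "1 \<le> b" "0 < X (N w' \<omega>) b w' \<omega> ! (j' - 1)"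
      by blast
    have "w' = w" using Suc.IH * by blast
    moreover have "w \<in> UH" using * by (auto dest: subsetD[OF infected_subset_UH])
    ultimately have "j = j'" using assms[of w a b j j'] * by blast
    with \<open>w' = w\<close> * show ?case by simp
  qed
  then show ?thesis unfolding contam_eq_card_infected by (auto simp: card_le_Suc0_iff_eq)
qed

context bwbp
begin

lemma Surv_measurable [measurable]: "Surv M N X z \<in> events"
  unfolding Surv_eq by measurable

lemma prob_Surv_pos:
  assumes "0 < prob (Surv M N X 1)" "1 \<le> z"
  shows "0 < prob (Surv M N X z)"
proof -
  have "Surv M N X 1 \<subseteq> Surv M N X z"
    using order_trans[OF _ contam_mono[OF assms(2), of N X]] by (auto simp: Surv_eq simp del: One_nat_def)
  then have "prob (Surv M N X 1) \<le> prob (Surv M N X z)"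
    by (intro finite_measure_mono) auto
  with assms show ?thesis by simp
qed

lemma prob_Surv_inter_eq_1:
  assumes "0 < prob (Surv M N X z)" "{\<omega> \<in> space M. P \<omega>} \<in> events"
    and "AE \<omega> in M. \<omega> \<in> Surv M N X z \<longrightarrow> P \<omega>"
  shows "prob ({\<omega> \<in> space M. P \<omega>} \<inter> Surv M N X z) / prob (Surv M N X z) = 1"
proof -
  have "prob ({\<omega> \<in> space M. P \<omega>} \<inter> Surv M N X z) = prob (Surv M N X z)"
    using assms(2,3) by (intro finite_measure_eq_AE) auto
  with assms(1) show ?thesis by simp
qed

lemma AE_contam_le_1:
  assumes null: "prob {\<omega> \<in> space M. 2 \<le> contam N X 2 1 \<omega>} = 0"
  shows "AE \<omega> in M. \<forall>n. contam N X z n \<omega> \<le> 1"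
proof -
  have zero: "prob A = 0" if "A \<subseteq> {\<omega> \<in> space M. 2 \<le> contam N X 2 1 \<omega>}" for A
    using finite_measure_mono[OF that] null by (simp add: measure_le_0_iff)
  define bad where "bad = (\<lambda>(v, k, a, b, j, j') \<omega>. v \<in> UH \<and> 1 \<le> a \<and> 1 \<le> b \<and> j \<noteq> j' \<and> j \<in> {1..k} \<and> j' \<in> {1..k} \<and>
    N v \<omega> = k \<and> 0 < X k a v \<omega> ! (j - 1) \<and> 0 < X k b v \<omega> ! (j' - 1))"
  have "AE \<omega> in M. \<not> bad p \<omega>" for p
  proof -
    obtain v k a b j j' where p: "p = (v, k, a, b, j, j')" by (cases p)
    show ?thesis
    proof (cases "v \<in> UH \<and> 1 \<le> a \<and> 1 \<le> b \<and> j \<noteq> j' \<and> j \<in> {1..k} \<and> j' \<in> {1..k}")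
      case True
      then have k: "1 \<le> k" by auto
      have [measurable]: "N v \<in> M \<rightarrow>\<^sub>M count_space UNIV" "X k a v \<in> M \<rightarrow>\<^sub>M count_space UNIV"
        "X k b v \<in> M \<rightarrow>\<^sub>M count_space UNIV"
        using True k by (auto intro: N_measurable X_measurable)
      have meas: "{\<omega> \<in> space M. N v \<omega> = k \<and> 0 < X k a v \<omega> ! (j - 1) \<and> 0 < X k b v \<omega> ! (j' - 1)} \<in> events"
        by measurable
      have "prob {\<omega> \<in> space M. N v \<omega> = k \<and> 0 < X k a v \<omega> ! (j - 1) \<and> 0 < X k b v \<omega> ! (j' - 1)} = 0"
      proof (cases "a = b")
        case ab: True
        have "prob {\<omega> \<in> space M. N v \<omega> = k \<and> 0 < X k a v \<omega> ! (j - 1) \<and> 0 < X k a v \<omega> ! (j' - 1)}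
            = prob {\<omega> \<in> space M. N [] \<omega> = k \<and> 0 < X k 1 [] \<omega> ! (j - 1) \<and> 0 < X k 1 [] \<omega> ! (j' - 1)}"
          using True k prob_N_X[of k _ _ "\<lambda>x. 0 < x ! (j - 1) \<and> 0 < x ! (j' - 1)"] by simp
        also have "\<dots> = 0"
          using True by (intro zero) (auto simp del: One_nat_def intro!: two_le_contam_1[where a = 1 and b = 1 and j = j and j' = j'])
        finally show ?thesis using ab by simp
      next
        case False
        have "prob {\<omega> \<in> space M. N v \<omega> = k \<and> 0 < X k a v \<omega> ! (j - 1) \<and> 0 < X k b v \<omega> ! (j' - 1)}
            = prob {\<omega> \<in> space M. N [] \<omega> = k \<and> 0 < X k 1 [] \<omega> ! (j - 1) \<and> 0 < X k 2 [] \<omega> ! (j' - 1)}"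
          using True False k prob_N_X_X[of k _ _ _ "\<lambda>x. 0 < x ! (j - 1)" "\<lambda>x. 0 < x ! (j' - 1)"] by simp
        also have "\<dots> = 0"
          using True by (intro zero) (auto simp del: One_nat_def intro!: two_le_contam_1[where a = 1 and b = 2 and j = j and j' = j'])
        finally show ?thesis .
      qed
      then show ?thesis
        using True meas by (intro AE_I[where N = "{\<omega> \<in> space M. N v \<omega> = k \<and> 0 < X k a v \<omega> ! (j - 1) \<and> 0 < X k b v \<omega> ! (j' - 1)}"])
          (auto simp: p bad_def emeasure_eq_measure)
    qed (auto simp: p bad_def)
  qed
  then have "AE \<omega> in M. \<forall>p. \<not> bad p \<omega>" by (simp add: AE_all_countable)
  then show ?thesis
  proof (rule AE_mp, intro AE_I2 impI allI)
    fix \<omega> n assume *: "\<forall>p. \<not> bad p \<omega>"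
    show "contam N X z n \<omega> \<le> 1"
    proof (rule contam_le_1)
      fix v a b j j'
      assume "v \<in> UH" "1 \<le> a" "1 \<le> b" "j \<noteq> j'" "j \<in> {1..N v \<omega>}" "j' \<in> {1..N v \<omega>}"
        "0 < X (N v \<omega>) a v \<omega> ! (j - 1)" "0 < X (N v \<omega>) b v \<omega> ! (j' - 1)"
      then have "bad (v, N v \<omega>, a, b, j, j') \<omega>" by (simp add: bad_def)
      with * show False by blast
    qed
  qed
qed

lemma prob_contam_1_2_pos:
  assumes two: "\<exists>k j. 1 \<le> j \<and> j \<le> k \<and>
      prob {\<omega> \<in> space M. N [] \<omega> = k} * prob {\<omega> \<in> space M. 2 \<le> X k 1 [] \<omega> ! (j - 1)} > 0"
    and pos: "0 < prob {\<omega> \<in> space M. 2 \<le> contam N X 2 1 \<omega>}"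
  shows "0 < prob {\<omega> \<in> space M. 2 \<le> contam N X 1 2 \<omega>}"
proof -
  from two obtain k j where kj: "1 \<le> j" "j \<le> k"
    "prob {\<omega> \<in> space M. N [] \<omega> = k} * prob {\<omega> \<in> space M. 2 \<le> X k 1 [] \<omega> ! (j - 1)} > 0" by blast
  define E where "E = {f \<in> space (PS (idx_below 1)). coordN [] f = k \<and> 2 \<le> coordX k 1 [] f ! (j - 1)}"
  have E: "E \<in> sets (PS (idx_below 1))" unfolding E_def by measurable
  have in_E: "past 1 \<omega> \<in> E \<longleftrightarrow> N [] \<omega> = k \<and> 2 \<le> X k 1 [] \<omega> ! (j - 1)" if "\<omega> \<in> space M" for \<omega>
  proof -
    have "coordN [] (past 1 \<omega>) = N [] \<omega>" "coordX k 1 [] (past 1 \<omega>) = X k 1 [] \<omega>"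
      using kj by (simp_all add: coordN_def coordX_def past_def obs_def idx_below_def)
    then show ?thesis
      using measurable_space[OF past_measurable[of 1] that] by (simp add: E_def)
  qed
  define l :: "nat \<Rightarrow> nat" where "l m = (if m = 1 then 2 else 0)" for m
  have l: "(\<forall>m. l m \<le> g m) \<longleftrightarrow> 2 \<le> g 1" for g :: "nat \<Rightarrow> nat"
    by (auto simp: l_def)
  have "{\<omega> \<in> space M. past 1 \<omega> \<in> E} = {\<omega> \<in> space M. N [] \<omega> = k \<and> 2 \<le> X k 1 [] \<omega> ! (j - 1)}"
    using in_E by blast
  with kj have "0 < prob {\<omega> \<in> space M. past 1 \<omega> \<in> E}"
    using prob_N_X[of k 1 "[]" "\<lambda>x. 2 \<le> x ! (j - 1)"] by simp
  with pos have "0 < prob {\<omega> \<in> space M. past 1 \<omega> \<in> E} * prob {\<omega> \<in> space M. 2 \<le> contam N X 2 1 \<omega>}"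
    by simp
  also have "\<dots> = prob {\<omega> \<in> space M. past 1 \<omega> \<in> E} * prob {\<omega> \<in> space M. \<forall>m. l m \<le> contam N X 2 m \<omega>} ^ card {[j]}"
    by (simp add: l)
  also have "\<dots> \<le> prob {\<omega> \<in> space M. past 1 \<omega> \<in> E \<and> (\<forall>m. card {[j]} * l m \<le> contam N X 1 (1 + m) \<omega>)}"
    using kj by (intro contam_branching E) (auto simp: in_E gen_def simp del: One_nat_def)
  also have "\<dots> \<le> prob {\<omega> \<in> space M. 2 \<le> contam N X 1 2 \<omega>}"
    by (intro finite_measure_mono) (auto simp: l numeral_2_eq_2)
  finally show ?thesis .
qed

lemma prob_contam_ge_2_pos:
  assumes pos: "0 < prob {\<omega> \<in> space M. 2 \<le> contam N X 1 2 \<omega>}"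
    and surv: "0 < prob (Surv M N X 1)"
  shows "0 < prob {\<omega> \<in> space M. \<forall>m\<ge>2. 2 \<le> contam N X 1 m \<omega>}"
proof -
  have "\<exists>F. finite F \<and> 0 < prob {\<omega> \<in> {\<omega> \<in> space M. 2 \<le> contam N X 1 2 \<omega>}. infected N X 1 2 \<omega> = F}"
  proof (rule ccontr)
    assume *: "\<not> ?thesis"
    have "1 * prob {\<omega> \<in> space M. 2 \<le> contam N X 1 2 \<omega>} \<le> prob ({\<omega> \<in> space M. 2 \<le> contam N X 1 2 \<omega>} \<inter> {})"
      by (rule prob_ge_countable_cases[OF infected_M countable_Collect_finite]) (use * in \<open>auto simp: not_less\<close>)
    with pos show False by simp
  qed
  then obtain F where fin: "finite F"
    and F_pos: "0 < prob {\<omega> \<in> {\<omega> \<in> space M. 2 \<le> contam N X 1 2 \<omega>}. infected N X 1 2 \<omega> = F}" by blast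
  then have "{\<omega> \<in> {\<omega> \<in> space M. 2 \<le> contam N X 1 2 \<omega>}. infected N X 1 2 \<omega> = F} \<noteq> {}"
    by (metis (no_types, lifting) measure_empty less_irrefl)
  then obtain \<omega>0 where "infected N X 1 2 \<omega>0 = F" "2 \<le> contam N X 1 2 \<omega>0" by auto
  then have F: "F \<subseteq> {v \<in> UH. length v = 2}" "2 \<le> card F"
    by (auto simp: contam_eq_card_infected dest: subsetD[OF infected_subset_UH])
  define E where "E = {f \<in> space (PS (idx_below 2)). infected coordN coordX 1 2 f = F}"
  have E: "E \<in> sets (PS (idx_below 2))"
  proof -
    have "E = infected coordN coordX 1 2 -` {F} \<inter> space (PS (idx_below 2))" by (auto simp: E_def)
    then show ?thesis using measurable_sets[OF infected_coord_measurable, of "{F}"] fin by simp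
  qed
  have in_E: "past 2 \<omega> \<in> E \<longleftrightarrow> infected N X 1 2 \<omega> = F" if "\<omega> \<in> space M" for \<omega>
    using measurable_space[OF past_measurable that] by (simp add: E_def infected_past[of 2 2])
  have "{\<omega> \<in> {\<omega> \<in> space M. 2 \<le> contam N X 1 2 \<omega>}. infected N X 1 2 \<omega> = F} = {\<omega> \<in> space M. past 2 \<omega> \<in> E}"
    using F by (auto simp: in_E contam_eq_card_infected)
  with F_pos surv have "0 < prob {\<omega> \<in> space M. past 2 \<omega> \<in> E}
      * prob {\<omega> \<in> space M. \<forall>m. 1 \<le> contam N X 1 m \<omega>} ^ card F"
    by (simp add: Surv_eq)
  also have "\<dots> \<le> prob {\<omega> \<in> space M. past 2 \<omega> \<in> E \<and> (\<forall>m. card F * 1 \<le> contam N X 1 (2 + m) \<omega>)}"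
    using F fin by (intro contam_branching E) (auto simp: in_E infected_def)
  also have "\<dots> \<le> prob {\<omega> \<in> space M. \<forall>m\<ge>2. 2 \<le> contam N X 1 m \<omega>}"
  proof (intro finite_measure_mono subsetI)
    fix \<omega> assume \<omega>: "\<omega> \<in> {\<omega> \<in> space M. past 2 \<omega> \<in> E \<and> (\<forall>m. card F * 1 \<le> contam N X 1 (2 + m) \<omega>)}"
    have "2 \<le> contam N X 1 m \<omega>" if "2 \<le> m" for m
    proof -
      from \<omega> have "card F * 1 \<le> contam N X 1 (2 + (m - 2)) \<omega>" by blast
      moreover have "2 + (m - 2) = m" using that by simp
      ultimately show ?thesis using F(2) by simp
    qed
    with \<omega> show "\<omega> \<in> {\<omega> \<in> space M. \<forall>m\<ge>2. 2 \<le> contam N X 1 m \<omega>}" by simp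
  qed measurable
  finally show ?thesis .
qed

lemma AE_contam_not_infinitely_often:
  assumes pos: "0 < prob {\<omega> \<in> space M. \<forall>m\<ge>2. 2 \<le> contam N X 1 m \<omega>}" and s: "1 \<le> s"
  shows "AE \<omega> in M. \<not> (\<exists>\<^sub>\<infinity>n. contam N X z n \<omega> = s)"
proof -
  define c where "c = prob {\<omega> \<in> space M. \<forall>m\<ge>2. 2 \<le> contam N X 1 m \<omega>} ^ s"
  define D where "D n = {\<omega> \<in> space M. contam N X z n \<omega> = s}" for n
  define B where "B n = {\<omega> \<in> space M. \<forall>m\<ge>n + 2. s < contam N X z m \<omega>}" for n
  define l :: "nat \<Rightarrow> nat" where "l m = (if 2 \<le> m then 2 else 0)" for m
  have l: "(\<forall>m. l m \<le> g m) \<longleftrightarrow> (\<forall>m\<ge>2. 2 \<le> g m)" for g :: "nat \<Rightarrow> nat"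
    by (auto simp: l_def)
  have c: "0 < c" using pos by (simp add: c_def)
  have D [measurable]: "D n \<in> events" for n unfolding D_def by measurable
  have B [measurable]: "B n \<in> events" for n unfolding B_def by measurable
  have "prob (\<Inter>m. \<Union>n\<in>{m..}. D n) = 0"
  proof (rule prob_limsup_eq_0[OF D B c])
    fix m n :: nat assume "m \<le> n"
    define V where "V = D n - \<Union>(D ` {m..<n})"
    have "c * prob V \<le> prob (V \<inter> B n)"
    proof (rule prob_ge_countable_cases[OF infected_M countable_Collect_finite])
      show "V \<in> events" unfolding V_def by (intro sets.Diff sets.finite_UN) auto
      fix F :: "nat list set" assume "F \<in> {F. finite F}"
      then have fin: "finite F" by simp
      show "c * prob {\<omega> \<in> V. infected N X z n \<omega> = F} \<le> prob {\<omega> \<in> V \<inter> B n. infected N X z n \<omega> = F}"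
      proof (cases "{\<omega> \<in> V. infected N X z n \<omega> = F} = {}")
        case True
        then show ?thesis unfolding True by simp
      next
        case False
        then obtain \<omega>0 where "infected N X z n \<omega>0 = F" "contam N X z n \<omega>0 = s" by (auto simp: V_def D_def)
        then have F: "F \<subseteq> {v \<in> UH. length v = n}" "card F = s"
          by (auto simp: contam_eq_card_infected dest: subsetD[OF infected_subset_UH])
        define E where "E = {f \<in> space (PS (idx_below n)). infected coordN coordX z n f = F
          \<and> (\<forall>k. m \<le> k \<and> k < n \<longrightarrow> contam coordN coordX z k f \<noteq> s)}"
        have E: "E \<in> sets (PS (idx_below n))"
        proof -
          have "E = (infected coordN coordX z n -` {F} \<inter> space (PS (idx_below n)))
             \<inter> {f \<in> space (PS (idx_below n)). \<forall>k. m \<le> k \<and> k < n \<longrightarrow> contam coordN coordX z k f \<noteq> s}"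
            by (auto simp: E_def)
          also have "\<dots> \<in> sets (PS (idx_below n))"
          proof (rule sets.Int)
            show "infected coordN coordX z n -` {F} \<inter> space (PS (idx_below n)) \<in> sets (PS (idx_below n))"
              using measurable_sets[OF infected_coord_measurable, of "{F}"] fin by simp
          qed measurable
          finally show ?thesis .
        qed
        have in_E: "past n \<omega> \<in> E \<longleftrightarrow> infected N X z n \<omega> = F \<and> (\<forall>k. m \<le> k \<and> k < n \<longrightarrow> contam N X z k \<omega> \<noteq> s)"
          if "\<omega> \<in> space M" for \<omega>
          using measurable_space[OF past_measurable that]
          by (auto simp: E_def infected_past[of n n] contam_past[of _ n])
        have V_F: "{\<omega> \<in> V. infected N X z n \<omega> = F} = {\<omega> \<in> space M. past n \<omega> \<in> E}"
          using F by (auto simp: V_def D_def in_E contam_eq_card_infected)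
        have "c * prob {\<omega> \<in> V. infected N X z n \<omega> = F} = prob {\<omega> \<in> space M. past n \<omega> \<in> E}
            * prob {\<omega> \<in> space M. \<forall>m. l m \<le> contam N X 1 m \<omega>} ^ card F"
          unfolding V_F l c_def F(2) by simp
        also have "\<dots> \<le> prob {\<omega> \<in> space M. past n \<omega> \<in> E \<and> (\<forall>m. card F * l m \<le> contam N X z (n + m) \<omega>)}"
          using F fin by (intro contam_branching E) (auto simp: in_E infected_def Suc_le_eq)
        also have "\<dots> \<le> prob {\<omega> \<in> V \<inter> B n. infected N X z n \<omega> = F}"
        proof (rule finite_measure_mono)
          have eq: "{\<omega> \<in> V \<inter> B n. infected N X z n \<omega> = F} = {\<omega> \<in> space M. past n \<omega> \<in> E} \<inter> B n"
            unfolding V_F[symmetric] by auto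
          show "{\<omega> \<in> V \<inter> B n. infected N X z n \<omega> = F} \<in> events"
            unfolding eq using E by measurable
          show "{\<omega> \<in> space M. past n \<omega> \<in> E \<and> (\<forall>m. card F * l m \<le> contam N X z (n + m) \<omega>)}
              \<subseteq> {\<omega> \<in> V \<inter> B n. infected N X z n \<omega> = F}"
            unfolding eq
          proof clarify
            fix \<omega> assume \<omega>: "\<omega> \<in> space M" "past n \<omega> \<in> E" "\<forall>m. card F * l m \<le> contam N X z (n + m) \<omega>"
            have "s < contam N X z k \<omega>" if "n + 2 \<le> k" for k
            proof -
              have "s * l (k - n) \<le> contam N X z (n + (k - n)) \<omega>" using \<omega>(3) F(2) by blast
              moreover have "n + (k - n) = k" "l (k - n) = 2" using that by (auto simp: l_def)
              ultimately show ?thesis using s by simp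
            qed
            with \<omega> show "\<omega> \<in> {\<omega> \<in> space M. past n \<omega> \<in> E} \<inter> B n" by (simp add: B_def)
          qed
        qed
        finally show ?thesis .
      qed
    qed (use c in auto)
    then show "c * prob (D n - \<Union>(D ` {m..<n})) \<le> prob ((D n - \<Union>(D ` {m..<n})) \<inter> B n)"
      by (simp add: V_def)
  next
    show "B n \<inter> (\<Inter>m. \<Union>k\<in>{m..}. D k) = {}" for n
      by (fastforce simp: B_def D_def)
  qed
  moreover have "(\<Inter>m. \<Union>n\<in>{m..}. D n) = {\<omega> \<in> space M. \<exists>\<^sub>\<infinity>n. contam N X z n \<omega> = s}"
    by (auto simp: D_def INFM_nat_le)
  ultimately show ?thesis
    by (intro AE_I[where N = "{\<omega> \<in> space M. \<exists>\<^sub>\<infinity>n. contam N X z n \<omega> = s}"])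
      (auto simp: emeasure_eq_measure INFM_nat_le)
qed

lemma AE_Surv_contam_at_top:
  assumes pos: "0 < prob {\<omega> \<in> space M. \<forall>m\<ge>2. 2 \<le> contam N X 1 m \<omega>}"
  shows "AE \<omega> in M. \<omega> \<in> Surv M N X z \<longrightarrow> filterlim (\<lambda>n. contam N X z n \<omega>) at_top sequentially"
proof -
  have "AE \<omega> in M. \<forall>s\<ge>1. \<not> (\<exists>\<^sub>\<infinity>n. contam N X z n \<omega> = s)"
    unfolding AE_all_countable using AE_contam_not_infinitely_often[OF pos] by auto
  then show ?thesis
  proof (rule AE_mp, intro AE_I2 impI)
    fix \<omega> assume fin: "\<forall>s\<ge>1. \<not> (\<exists>\<^sub>\<infinity>n. contam N X z n \<omega> = s)" and surv: "\<omega> \<in> Surv M N X z"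
    show "filterlim (\<lambda>n. contam N X z n \<omega>) at_top sequentially"
      unfolding filterlim_at_top
    proof
      fix c
      have "eventually (\<lambda>n. \<forall>s\<in>{1..<c}. contam N X z n \<omega> \<noteq> s) sequentially"
        using fin by (intro eventually_ball_finite) (auto simp: frequently_def cofinite_eq_sequentially)
      then show "eventually (\<lambda>n. c \<le> contam N X z n \<omega>) sequentially"
        by (rule eventually_mono) (use surv in \<open>auto simp: Surv_eq not_less[symmetric]\<close>)
    qed
  qed
qed

end

theorem theorem2:
  fixes M :: "'a measure"
    and N :: "nat list \<Rightarrow> 'a \<Rightarrow> nat"
    and X :: "nat \<Rightarrow> nat \<Rightarrow> nat list \<Rightarrow> 'a \<Rightarrow> nat list"
  assumes model: "bwbp_model M N X"
    and nu_finite: "(\<integral>\<^sup>+ \<omega>. ennreal (real (N [] \<omega>)) \<partial>M) < \<infinity>"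
    and gamma_pos: "0 < bwbp_gamma M N X"
    and gamma_fin: "bwbp_gamma M N X < \<infinity>"
    and p1: "measure M {\<omega> \<in> space M. N [] \<omega> = 1} < 1"
    and Z1: "measure M {\<omega> \<in> space M. totalZ N X 1 1 \<omega> = 1} < 1"
    and two: "\<exists>k j. 1 \<le> j \<and> j \<le> k \<and>
                measure M {\<omega> \<in> space M. N [] \<omega> = k} *
                measure M {\<omega> \<in> space M. 2 \<le> X k 1 [] \<omega> ! (j - 1)} > 0"
    and surv: "measure M (Surv M N X 1) > 0"
  shows
    "(measure M {\<omega> \<in> space M. 2 \<le> contam N X 2 1 \<omega>} > 0 \<longrightarrow>
       (\<forall>z::nat. 1 \<le> z \<longrightarrow>
          measure M ({\<omega> \<in> space M. filterlim (\<lambda>n. contam N X z n \<omega>) at_top sequentially}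
                     \<inter> Surv M N X z) / measure M (Surv M N X z) = 1 \<and>
          (AE \<omega> in M. (\<omega> \<in> Ext M N X z \<longleftrightarrow> bdd_above (range (\<lambda>n. contam N X z n \<omega>))))))
     \<and>
     (measure M {\<omega> \<in> space M. 2 \<le> contam N X 2 1 \<omega>} = 0 \<longrightarrow>
       (\<forall>z::nat. 1 \<le> z \<longrightarrow>
          measure M ({\<omega> \<in> space M. \<forall>n. contam N X z n \<omega> = 1} \<inter> Surv M N X z)
            / measure M (Surv M N X z) = 1))"
proof -
  have "prob_space M" using model unfolding bwbp_model_def by (rule conjunct1)
  then interpret bwbp M N X by (rule bwbp.intro[OF _ bwbp_axioms.intro[OF model]])
  show ?thesis
  proof (intro conjI impI allI)
    fix z :: nat
    assume a: "0 < prob {\<omega> \<in> space M. 2 \<le> contam N X 2 1 \<omega>}" and z: "1 \<le> z"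
    have to_infinity: "AE \<omega> in M. \<omega> \<in> Surv M N X z \<longrightarrow>
        filterlim (\<lambda>n. contam N X z n \<omega>) at_top sequentially"
      by (intro AE_Surv_contam_at_top prob_contam_ge_2_pos prob_contam_1_2_pos two a surv)
    show "prob ({\<omega> \<in> space M. filterlim (\<lambda>n. contam N X z n \<omega>) at_top sequentially}
        \<inter> Surv M N X z) / prob (Surv M N X z) = 1"
    proof (rule prob_Surv_inter_eq_1[OF prob_Surv_pos[OF surv z] _ to_infinity])
      show "{\<omega> \<in> space M. filterlim (\<lambda>n. contam N X z n \<omega>) at_top sequentially} \<in> events"
        unfolding filterlim_at_top eventually_sequentially by measurable
    qed
    show "AE \<omega> in M. \<omega> \<in> Ext M N X z \<longleftrightarrow> bdd_above (range (\<lambda>n. contam N X z n \<omega>))"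
      using to_infinity
    proof (rule AE_mp, intro AE_I2 impI)
      fix \<omega> assume \<omega>: "\<omega> \<in> space M"
        and lim: "\<omega> \<in> Surv M N X z \<longrightarrow> filterlim (\<lambda>n. contam N X z n \<omega>) at_top sequentially"
      show "\<omega> \<in> Ext M N X z \<longleftrightarrow> bdd_above (range (\<lambda>n. contam N X z n \<omega>))"
      proof
        assume "\<omega> \<in> Ext M N X z"
        then obtain k where k: "contam N X z k \<omega> = 0" by (auto simp: Ext_eq)
        have "range (\<lambda>n. contam N X z n \<omega>) \<subseteq> insert 0 ((\<lambda>n. contam N X z n \<omega>) ` {..<k})"
          using contam_eq_0_mono[OF _ k] by (auto simp: image_iff not_less[symmetric])
        then show "bdd_above (range (\<lambda>n. contam N X z n \<omega>))"
          by (meson bdd_above_finite finite_imageI finite_insert finite_lessThan finite_subset)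
      next
        assume "bdd_above (range (\<lambda>n. contam N X z n \<omega>))"
        then obtain K where K: "contam N X z n \<omega> \<le> K" for n by (auto simp: bdd_above_def)
        have "\<not> filterlim (\<lambda>n. contam N X z n \<omega>) at_top sequentially"
        proof
          assume "filterlim (\<lambda>n. contam N X z n \<omega>) at_top sequentially"
          then obtain n where "Suc K \<le> contam N X z n \<omega>"
            by (auto simp only: filterlim_at_top eventually_sequentially)
          with K[of n] show False by simp
        qed
        with lim \<omega> show "\<omega> \<in> Ext M N X z" by (auto simp: Surv_def)
      qed
    qed
  next
    fix z :: nat
    assume b: "prob {\<omega> \<in> space M. 2 \<le> contam N X 2 1 \<omega>} = 0" and z: "1 \<le> z"
    show "prob ({\<omega> \<in> space M. \<forall>n. contam N X z n \<omega> = 1} \<inter> Surv M N X z) / prob (Surv M N X z) = 1"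
    proof (rule prob_Surv_inter_eq_1[OF prob_Surv_pos[OF surv z]])
      show "AE \<omega> in M. \<omega> \<in> Surv M N X z \<longrightarrow> (\<forall>n. contam N X z n \<omega> = 1)"
        using AE_contam_le_1[OF b] by (rule AE_mp) (auto simp: Surv_eq intro!: antisym)
    qed measurable
  qed
qed

end
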